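(* The number of cubic graphs $G$ (up to isomorphism) with $A_b(G)<5$ is not finite.
   Context: All graphs are finite and simple. A graph is cubic if it is 3-regular. Write $[k]=\{1,\dots,k\}$. A $k$-coloring of $G$ is a map $c:V(G)\to[k]$ with $c(u)\neq c(v)$ for every edge $uv$; its color classes are $V_i=\{v\in V(G): c(v)=i\}$. An acyclic $k$-coloring is a $k$-coloring such that, for any two colors $i,j$, the subgraph induced by $V_i\cup V_j$ is a forest (contains no cycle). Here a coloring "with $k$ colors" means all $k$ colors are used. Let $c$ be an acyclic coloring of $G$ with color set $[k]$. An acyclic recoloring step is possible for $c$ if there exist a color $i\in[k]$ and a choice of colors $\ell_v\in[k]\setminus\{i\}$, one for each $v\in V_i$, with $\ell_v$ not appearing under $c$ in the closed neighborhood of $v$, such that the map $c_i:V(G)\to[k]\setminus\{i\}$ defined by $c_i(v)=c(v)$ if $c(v)\neq i$ and $c_i(v)=\ell_v$ if $c(v)=i$ is again an acyclic coloring of $G$. The acyclic b-chromatic number $A_b(G)$ is the maximum number $k$ of colors in an acyclic coloring of $G$ for which no acyclic recoloring step is possible. (Equivalently, it is the maximum number of colors in a coloring obtained by starting with the trivial coloring, in which all vertices have distinct colors, and performing acyclic recoloring steps until none is possible.) *)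

theory Defs
  imports "Graph_Theory.Graph_Theory"
begin

text \<open>
  Finite simple graphs are the \<open>pair_graph\<close>s of the Graph Theory entry: finite, loop-free digraphs
  without parallel arcs whose arc relation is symmetric, an edge \<open>uv\<close> being the two arcs \<open>(u,v)\<close>
  and \<open>(v,u)\<close>.
\<close>

definition cubic :: "('a,'b) pre_digraph \<Rightarrow> bool" where
  "cubic G \<longleftrightarrow> (\<forall>v\<in>verts G. out_degree G v = 3)"

text \<open>
  In a symmetric digraph every edge gives a directed cycle \<open>u, v, u\<close>, so the library predicate
  \<open>forest\<close> fails as soon as there is an edge. The cycles of a simple graph are the directed cycles
  of length at least 3.
\<close>

definition undirected_forest :: "('a,'b) pre_digraph \<Rightarrow> bool" where
  "undirected_forest G \<longleftrightarrow> \<not> (\<exists>p. pre_digraph.cycle G p \<and> 3 \<le> length p)"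

definition color_class :: "('a,'b) pre_digraph \<Rightarrow> ('a \<Rightarrow> nat) \<Rightarrow> nat \<Rightarrow> 'a set" where
  "color_class G c i = {v \<in> verts G. c v = i}"

definition coloring :: "('a,'b) pre_digraph \<Rightarrow> nat set \<Rightarrow> ('a \<Rightarrow> nat) \<Rightarrow> bool" where
  "coloring G C c \<longleftrightarrow> (\<forall>v\<in>verts G. c v \<in> C) \<and> (\<forall>u v. u \<rightarrow>\<^bsub>G\<^esub> v \<longrightarrow> c u \<noteq> c v)"

definition acyclic_coloring :: "('a,'b) pre_digraph \<Rightarrow> nat set \<Rightarrow> ('a \<Rightarrow> nat) \<Rightarrow> bool" where
  "acyclic_coloring G C c \<longleftrightarrow> coloring G C c \<and>
     (\<forall>i\<in>C. \<forall>j\<in>C. undirected_forest (G \<restriction> (color_class G c i \<union> color_class G c j)))"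

definition closed_neighborhood :: "('a,'b) pre_digraph \<Rightarrow> 'a \<Rightarrow> 'a set" where
  "closed_neighborhood G v = insert v {w. v \<rightarrow>\<^bsub>G\<^esub> w}"

definition acyclic_recoloring_step_possible ::
    "('a,'b) pre_digraph \<Rightarrow> nat set \<Rightarrow> ('a \<Rightarrow> nat) \<Rightarrow> bool" where
  "acyclic_recoloring_step_possible G C c \<longleftrightarrow>
     (\<exists>i\<in>C. \<exists>l.
        (\<forall>v\<in>color_class G c i. l v \<in> C - {i} \<and> l v \<notin> c ` closed_neighborhood G v) \<and>
        acyclic_coloring G (C - {i}) (\<lambda>v. if c v = i then l v else c v))"

definition stuck_color_numbers :: "('a,'b) pre_digraph \<Rightarrow> nat set" where
  "stuck_color_numbers G =
     {k. \<exists>c. acyclic_coloring G {1..k} c \<and> c ` verts G = {1..k} \<and>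
             \<not> acyclic_recoloring_step_possible G {1..k} c}"

definition acyclic_b_chromatic_number :: "('a,'b) pre_digraph \<Rightarrow> nat" where
  "acyclic_b_chromatic_number G = Max (stuck_color_numbers G)"

text \<open>
  Every finite graph has an isomorphic copy on natural-number vertices, so the classes of this
  relation are the isomorphism types of finite simple graphs.
\<close>

definition graph_iso_rel :: "nat pair_pre_digraph rel" where
  "graph_iso_rel = {(G, H). pair_graph G \<and> pair_graph H \<and> digraph_iso (with_proj G) (with_proj H)}"

lemma equiv_graph_iso_rel: "equiv {G. pair_graph G} graph_iso_rel"
proof (rule equivI)
  show "graph_iso_rel \<subseteq> {G. pair_graph G} \<times> {G. pair_graph G}"
    by (auto simp: graph_iso_rel_def)
  show "refl_on {G. pair_graph G} graph_iso_rel"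
  proof (rule refl_onI)
    fix G :: "nat pair_pre_digraph" assume "G \<in> {G. pair_graph G}"
    then interpret pair_graph G by simp
    let ?f = "\<lparr>iso_verts = id, iso_arcs = id, iso_head = snd, iso_tail = fst\<rparr>"
    have "digraph_isomorphism ?f"
      using wf_digraph by (auto simp: digraph_isomorphism_def)
    moreover have "with_proj G = app_iso ?f (with_proj G)"
      by (simp add: app_iso_def with_proj_def)
    ultimately show "(G, G) \<in> graph_iso_rel"
      using pair_graph unfolding graph_iso_rel_def digraph_iso_def by blast
  qed
  show "sym graph_iso_rel"
  proof (rule symI)
    fix G H assume *: "(G, H) \<in> graph_iso_rel"
    then interpret pair_graph G by (simp add: graph_iso_rel_def)
    show "(H, G) \<in> graph_iso_rel"
      using * digraph_iso_swap[OF wf_digraph] by (auto simp: graph_iso_rel_def)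
  qed
  show "trans graph_iso_rel"
    by (rule transI) (auto simp: graph_iso_rel_def intro: digraph_iso_trans)
qed

text \<open>The maximum defining the acyclic b-chromatic number is over a finite nonempty set.\<close>

lemma finite_stuck_color_numbers:
  assumes "finite (verts G)"
  shows "finite (stuck_color_numbers G)"
proof (rule finite_subset)
  show "stuck_color_numbers G \<subseteq> {..card (verts G)}"
  proof
    fix k assume "k \<in> stuck_color_numbers G"
    then obtain c where "c ` verts G = {1..k}" by (auto simp: stuck_color_numbers_def)
    then have "card {1..k} \<le> card (verts G)" using card_image_le[OF assms, of c] by simp
    then show "k \<in> {..card (verts G)}" by simp
  qed
qed simp

lemma acyclic_coloring_rename:
  assumes "wf_digraph G" "acyclic_coloring G C c" "inj_on f C"
  shows "acyclic_coloring G (f ` C) (f \<circ> c)"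
proof -
  have C: "c v \<in> C" if "v \<in> verts G" for v
    using that assms by (auto simp: acyclic_coloring_def coloring_def)
  have cl: "color_class G (f \<circ> c) (f i) = color_class G c i" if "i \<in> C" for i
    using that C assms(3) by (auto simp: color_class_def inj_on_def)
  have "f (c u) \<noteq> f (c v)" if "u \<rightarrow>\<^bsub>G\<^esub> v" for u v
  proof -
    have "c u \<noteq> c v" "u \<in> verts G" "v \<in> verts G"
      using that assms(2) wf_digraph.adj_in_verts[OF assms(1) that]
      by (auto simp: acyclic_coloring_def coloring_def)
    then show ?thesis using C assms(3) by (auto dest: inj_onD)
  qed
  then have "coloring G (f ` C) (f \<circ> c)" using C by (auto simp: coloring_def)
  then show ?thesis using assms(2) cl by (auto simp: acyclic_coloring_def)
qed

lemma acyclic_coloring_inj: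
  assumes "wf_digraph G" "loopfree_digraph G" "inj_on c (verts G)" "c ` verts G \<subseteq> C"
  shows "acyclic_coloring G C c"
proof -
  have "c u \<noteq> c v" if "u \<rightarrow>\<^bsub>G\<^esub> v" for u v
    using wf_digraph.adj_in_verts[OF assms(1) that] loopfree_digraph.adj_not_same[OF assms(2)] that
      assms(3) by (metis inj_onD)
  then have "coloring G C c" using assms(4) by (auto simp: coloring_def)
  moreover have "undirected_forest (G \<restriction> (color_class G c i \<union> color_class G c j))" for i j
    unfolding undirected_forest_def
  proof
    let ?S = "color_class G c i \<union> color_class G c j"
    assume "\<exists>p. pre_digraph.cycle (G \<restriction> ?S) p \<and> 3 \<le> length p"
    then obtain p u where p: "pre_digraph.awalk (G \<restriction> ?S) u p u"
        "distinct (tl (pre_digraph.awalk_verts (G \<restriction> ?S) u p))" "3 \<le> length p"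
      by (auto simp: pre_digraph.cycle_def)
    interpret H: wf_digraph "G \<restriction> ?S"
      using wf_digraph.wellformed_induce_subgraph[OF assms(1)] .
    let ?vs = "tl (H.awalk_verts u p)"
    have one: "\<exists>x. color_class G c m \<subseteq> {x}" for m
    proof (cases "color_class G c m = {}")
      case False
      then obtain x where "x \<in> color_class G c m" by blast
      then have "color_class G c m \<subseteq> {x}" using assms(3) by (auto simp: color_class_def inj_on_def)
      then show ?thesis by blast
    qed simp
    obtain x y where "?S \<subseteq> {x, y}" using one[of i] one[of j] by blast
    moreover have "set ?vs \<subseteq> ?S"
    proof -
      have "set (H.awalk_verts u p) \<subseteq> verts (G \<restriction> ?S)"
        using p(1) by (rule H.awalkE)
      moreover have "set ?vs \<subseteq> set (H.awalk_verts u p)"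
        by (cases "H.awalk_verts u p") auto
      ultimately show ?thesis by simp
    qed
    ultimately have "card (set ?vs) \<le> card {x, y}" by (intro card_mono) auto
    also have "\<dots> \<le> 2" by (simp add: card_insert_if)
    finally have "length ?vs \<le> 2" using p(2) by (simp add: distinct_card)
    moreover have "length ?vs = length p"
      by (simp add: H.length_awalk_verts)
    ultimately show False using p(3) by simp
  qed
  ultimately show ?thesis by (simp add: acyclic_coloring_def)
qed

lemma stuck_color_numbers_nonempty:
  assumes "finite (verts G)" "wf_digraph G" "loopfree_digraph G"
  shows "stuck_color_numbers G \<noteq> {}"
proof -
  define P where "P k \<longleftrightarrow> (\<exists>c. acyclic_coloring G {1..k} c \<and> c ` verts G = {1..k})" for k
  obtain h where h: "bij_betw h (verts G) {1..card (verts G)}"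
    using finite_same_card_bij[OF assms(1), of "{1..card (verts G)}"] by auto
  then have "acyclic_coloring G {1..card (verts G)} h" "h ` verts G = {1..card (verts G)}"
    using acyclic_coloring_inj[OF assms(2,3), of h] by (simp_all add: bij_betw_def)
  then have "P (card (verts G))" unfolding P_def by blast
  then have P: "P (LEAST k. P k)" and least: "\<And>k. P k \<Longrightarrow> (LEAST k. P k) \<le> k"
    by (auto intro: LeastI Least_le)
  define k where "k = (LEAST k. P k)"
  obtain c where c: "acyclic_coloring G {1..k} c" "c ` verts G = {1..k}"
    using P by (auto simp: P_def k_def)
  have "\<not> acyclic_recoloring_step_possible G {1..k} c"
  proof
    assume "acyclic_recoloring_step_possible G {1..k} c"
    then obtain i l where i: "i \<in> {1..k}"
      and l: "\<forall>v\<in>color_class G c i. l v \<in> {1..k} - {i} \<and> l v \<notin> c ` closed_neighborhood G v"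
      and d: "acyclic_coloring G ({1..k} - {i}) (\<lambda>v. if c v = i then l v else c v)"
      unfolding acyclic_recoloring_step_possible_def by blast
    let ?d = "\<lambda>v. if c v = i then l v else c v"
    have sur: "?d ` verts G = {1..k} - {i}"
    proof
      show "?d ` verts G \<subseteq> {1..k} - {i}"
        using d by (auto simp: acyclic_coloring_def coloring_def)
      show "{1..k} - {i} \<subseteq> ?d ` verts G"
      proof
        fix x assume x: "x \<in> {1..k} - {i}"
        then obtain v where "v \<in> verts G" "c v = x" using c(2) by (metis DiffD1 imageE)
        then show "x \<in> ?d ` verts G" using x by (intro image_eqI[of _ _ v]) auto
      qed
    qed
    have "card ({1..k} - {i}) = card {1..k - 1}" using i by simp
    then obtain f where f: "bij_betw f ({1..k} - {i}) {1..k - 1}"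
      using finite_same_card_bij by blast
    then have inj: "inj_on f ({1..k} - {i})" and im: "f ` ({1..k} - {i}) = {1..k - 1}"
      by (auto simp: bij_betw_def)
    have "acyclic_coloring G {1..k - 1} (f \<circ> ?d)"
      using acyclic_coloring_rename[OF assms(2) d inj] im by simp
    moreover have "(f \<circ> ?d) ` verts G = {1..k - 1}"
      using sur im by (metis image_comp)
    ultimately have "P (k - 1)" unfolding P_def by blast
    then have "k \<le> k - 1" using least k_def by simp
    then show False using i by simp
  qed
  then show ?thesis using c by (auto simp: stuck_color_numbers_def)
qed

end

theory Submission
  imports Defs
begin

text \<open>
  In a disjoint union of copies of \<open>K\<^sub>4\<close> every proper coloring is acyclic, since a cycle has three
  vertices in one clique and these get three colors. With at least five colors, each vertex of a
  color class misses some color in its clique, so the whole class can be recolored. Hence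
  \<open>A\<^sub>b(n K\<^sub>4) < 5\<close> for every \<open>n\<close>.
\<close>

text \<open>The disjoint union of the complete graphs on the fibres of \<open>f\<close>. The facts
  below then depend only on fibre sizes; fibres of size 4 give the copies of
  \<open>K\<^sub>4\<close>.\<close>

definition cluster_graph :: "'a set \<Rightarrow> ('a \<Rightarrow> 'b) \<Rightarrow> 'a pair_pre_digraph" where
  "cluster_graph V f = \<lparr>pverts = V, parcs = {(u, v). u \<in> V \<and> v \<in> V \<and> u \<noteq> v \<and> f u = f v}\<rparr>"

lemma verts_cluster_graph [simp]: "pverts (cluster_graph V f) = V"
  by (simp add: cluster_graph_def)

lemma parcs_cluster_graph [simp]:
  "(u, v) \<in> parcs (cluster_graph V f) \<longleftrightarrow> u \<in> V \<and> v \<in> V \<and> u \<noteq> v \<and> f u = f v"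
  by (simp add: cluster_graph_def)

lemma pair_graph_cluster_graph:
  assumes "finite V"
  shows "pair_graph (cluster_graph V f)"
proof
  show "finite (parcs (cluster_graph V f))"
    by (rule finite_subset[of _ "V \<times> V"]) (auto simp: cluster_graph_def assms)
qed (auto simp: assms cluster_graph_def symmetric_def sym_def arcs_ends_def arc_to_ends_def)

lemma closed_neighborhood_cluster_graph:
  assumes "v \<in> V"
  shows "closed_neighborhood (with_proj (cluster_graph V f)) v = {w \<in> V. f w = f v}"
  using assms by (auto simp: closed_neighborhood_def)

lemma cubic_cluster_graph:
  assumes "finite V" "\<And>v. v \<in> V \<Longrightarrow> card {w \<in> V. f w = f v} = 4"
  shows "cubic (with_proj (cluster_graph V f))"
  unfolding cubic_def
proof
  fix v assume "v \<in> verts (with_proj (cluster_graph V f))"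
  then have v: "v \<in> V" by simp
  have "out_arcs (with_proj (cluster_graph V f)) v = Pair v ` ({w \<in> V. f w = f v} - {v})"
    using v by (auto simp: out_arcs_def cluster_graph_def)
  then show "out_degree (with_proj (cluster_graph V f)) v = 3"
    using v assms by (simp add: out_degree_def card_image inj_on_def)
qed

text \<open>An arc joins two vertices of one fibre, so a walk cannot leave the fibre of its start.
  The induced subgraph on \<open>S\<close> is there for the two-color subgraphs of a
  coloring.\<close>

lemma awalk_same_block:
  assumes "pre_digraph.awalk (with_proj (cluster_graph V f) \<restriction> S) u p v"
    and "w \<in> set (pre_digraph.awalk_verts (with_proj (cluster_graph V f) \<restriction> S) u p)"
  shows "f w = f u"
proof -
  let ?G = "with_proj (cluster_graph V f)"
  have "wf_digraph ?G" by unfold_locales (auto simp: cluster_graph_def)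
  then interpret H: wf_digraph "?G \<restriction> S"
    by (rule wf_digraph.wellformed_induce_subgraph)
  show ?thesis using assms
  proof (induction p arbitrary: u)
    case Nil
    then show ?case by simp
  next
    case (Cons e p)
    then have e: "e \<in> parcs (cluster_graph V f)" "u = fst e" "H.awalk (snd e) p v"
      by (auto simp: H.awalk_Cons_iff)
    then have "f u = f (snd e)" by (auto simp: cluster_graph_def)
    then show ?case using Cons e by auto
  qed
qed

lemma acyclic_coloring_cluster_graph:
  assumes "coloring (with_proj (cluster_graph V f)) C c"
  shows "acyclic_coloring (with_proj (cluster_graph V f)) C c"
proof -
  let ?G = "with_proj (cluster_graph V f)"
  have "undirected_forest (?G \<restriction> (color_class ?G c i \<union> color_class ?G c j))" for i j
    unfolding undirected_forest_def
  proof
    let ?S = "color_class ?G c i \<union> color_class ?G c j"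
    assume "\<exists>p. pre_digraph.cycle (?G \<restriction> ?S) p \<and> 3 \<le> length p"
    then obtain p u where p: "pre_digraph.awalk (?G \<restriction> ?S) u p u"
        "distinct (tl (pre_digraph.awalk_verts (?G \<restriction> ?S) u p))" "3 \<le> length p"
      by (auto simp: pre_digraph.cycle_def)
    have "wf_digraph ?G" by unfold_locales (auto simp: cluster_graph_def)
    then interpret H: wf_digraph "?G \<restriction> ?S"
      by (rule wf_digraph.wellformed_induce_subgraph)
    let ?vs = "tl (H.awalk_verts u p)"
    have sub: "set ?vs \<subseteq> set (H.awalk_verts u p)"
      by (cases "H.awalk_verts u p") auto
    have S: "set ?vs \<subseteq> ?S"
      using sub H.awalkE[OF p(1)] by auto
    have block: "f w = f u" if "w \<in> set ?vs" for w
      using awalk_same_block[OF p(1)] sub that by blast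
    \<comment> \<open>Distinct vertices of the cycle share a fibre, so they are adjacent in the
      whole graph and a proper coloring separates them.\<close>
    have "inj_on c (set ?vs)"
    proof (rule inj_onI, rule ccontr)
      fix x y assume xy: "x \<in> set ?vs" "y \<in> set ?vs" "c x = c y" "x \<noteq> y"
      then have "x \<in> V" "y \<in> V" using S by (auto simp: color_class_def)
      then have "x \<rightarrow>\<^bsub>?G\<^esub> y" using xy block by simp
      then show False using assms xy by (auto simp: coloring_def)
    qed
    moreover have "c ` set ?vs \<subseteq> {i, j}" using S by (auto simp: color_class_def)
    ultimately have "card (set ?vs) \<le> card {i, j}" by (intro card_inj_on_le) auto
    also have "\<dots> \<le> 2" by (simp add: card_insert_if)
    finally show False using p(2,3) by (simp add: distinct_card H.length_awalk_verts)
  qed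
  then show ?thesis using assms by (simp add: acyclic_coloring_def)
qed

text \<open>Pigeonhole: a closed neighborhood is a whole clique and has fewer vertices than there
  are colors, so each vertex has a free color. Properness of the new coloring suffices, since
  acyclicity follows from it. Any class \<open>i\<close> can be removed.\<close>

lemma cluster_graph_recoloring_step:
  assumes "finite V" "\<And>v. v \<in> V \<Longrightarrow> card {w \<in> V. f w = f v} < card C"
    and c: "coloring (with_proj (cluster_graph V f)) C c" and i: "i \<in> C"
  shows "acyclic_recoloring_step_possible (with_proj (cluster_graph V f)) C c"
proof -
  let ?G = "with_proj (cluster_graph V f)"
  have "\<exists>a. a \<in> C - c ` closed_neighborhood ?G v" if "v \<in> V" for v
  proof -
    let ?N = "closed_neighborhood ?G v"
    have "finite ?N" "card ?N < card C"
      using that assms(1,2) by (simp_all add: closed_neighborhood_cluster_graph)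
    then have "\<not> C \<subseteq> c ` ?N"
      using card_image_le[of ?N c] card_mono[of "c ` ?N" C] by fastforce
    then show ?thesis by blast
  qed
  then obtain l where l: "\<And>v. v \<in> V \<Longrightarrow> l v \<in> C \<and> l v \<notin> c ` closed_neighborhood ?G v"
    by (metis DiffE)
  \<comment> \<open>With \<open>w = u\<close> this shows that a vertex of color \<open>i\<close>
    does not get \<open>i\<close> back. With adjacent \<open>u\<close> and \<open>w\<close> it
    settles the edges with one recolored end; no edge has two, as both ends would have had color
    \<open>i\<close>.\<close>
  have ne: "l u \<noteq> c w" if "u \<in> V" "w \<in> V" "f w = f u" for u w
    using l[OF that(1)] that by (auto simp: closed_neighborhood_cluster_graph)
  have "coloring ?G (C - {i}) (\<lambda>v. if c v = i then l v else c v)"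
    unfolding coloring_def
  proof (intro conjI ballI allI impI)
    fix v assume "v \<in> verts ?G"
    then show "(if c v = i then l v else c v) \<in> C - {i}"
      using c l ne[of v v] by (auto simp: coloring_def)
  next
    fix u v assume "u \<rightarrow>\<^bsub>?G\<^esub> v"
    then have uv: "u \<in> V" "v \<in> V" "f u = f v" "c u \<noteq> c v"
      using c unfolding coloring_def by auto
    then show "(if c u = i then l u else c u) \<noteq> (if c v = i then l v else c v)"
      using ne[of u v] ne[of v u] by auto
  qed
  then have "acyclic_coloring ?G (C - {i}) (\<lambda>v. if c v = i then l v else c v)"
    by (rule acyclic_coloring_cluster_graph)
  moreover have "\<forall>v\<in>color_class ?G c i. l v \<in> C - {i} \<and> l v \<notin> c ` closed_neighborhood ?G v"
    using l ne by (fastforce simp: color_class_def)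
  ultimately show ?thesis
    using i unfolding acyclic_recoloring_step_possible_def by blast
qed

lemma acyclic_b_chromatic_number_cluster_graph:
  assumes "finite V" "\<And>v. v \<in> V \<Longrightarrow> card {w \<in> V. f w = f v} \<le> m"
  shows "acyclic_b_chromatic_number (with_proj (cluster_graph V f)) \<le> m"
proof -
  let ?G = "with_proj (cluster_graph V f)"
  interpret pair_graph "cluster_graph V f" by (rule pair_graph_cluster_graph[OF assms(1)])
  have "k \<le> m" if "k \<in> stuck_color_numbers ?G" for k
  proof (rule ccontr)
    assume "\<not> k \<le> m"
    \<comment> \<open>Color 1 serves as the class to remove; it exists because \<open>k > m\<close>
      forces \<open>k \<ge> 1\<close>.\<close>
    then have "\<And>v. v \<in> V \<Longrightarrow> card {w \<in> V. f w = f v} < card {1..k}" "1 \<in> {1..k}"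
      using assms(2) by fastforce+
    then show False
      using that cluster_graph_recoloring_step[OF assms(1), of f "{1..k}"]
      by (auto simp: stuck_color_numbers_def acyclic_coloring_def)
  qed
  \<comment> \<open>These make \<open>Max\<close> a genuine maximum, so a bound on all elements
    bounds it.\<close>
  moreover have "finite (stuck_color_numbers ?G)" "stuck_color_numbers ?G \<noteq> {}"
    using assms(1) wf_digraph loopfree_digraph_axioms
    by (simp_all add: finite_stuck_color_numbers stuck_color_numbers_nonempty)
  ultimately show ?thesis by (simp add: acyclic_b_chromatic_number_def)
qed

text \<open>The invariant that tells the graphs of the family apart.\<close>

lemma digraph_iso_card_verts:
  assumes "digraph_iso G H"
  shows "card (verts G) = card (verts H)"
proof -
  obtain h where "pre_digraph.digraph_isomorphism G h" "H = app_iso h G"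
    using assms by (auto simp: digraph_iso_def)
  then show ?thesis
    by (simp add: pre_digraph.digraph_isomorphism_def card_image)
qed

lemma card_div_block:
  fixes v d n :: nat
  assumes "v < d * n"
  shows "card {w \<in> {..<d * n}. w div d = v div d} = d"
proof -
  have d: "d > 0" using assms by (cases d) auto
  define q where "q = v div d"
  have "q < n" using assms by (simp add: q_def less_mult_imp_div_less mult.commute)
  \<comment> \<open>The block of quotient \<open>q\<close> is an interval of length
    \<open>d\<close>; this bound says that the range does not cut it off, even for the last
    block.\<close>
  then have "d * q + d \<le> d * n" using mult_le_mono2[of "Suc q" n d] by simp
  then have "{w \<in> {..<d * n}. w div d = q} = {d * q..<d * q + d}"
    using d by (auto simp: div_nat_eqI mult.commute dividend_less_times_div[OF d, unfolded add.commute[of d]])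
  then show ?thesis by (simp add: q_def)
qed

theorem corollary3p6:
  shows "infinite ({G :: nat pair_pre_digraph. pair_graph G \<and> cubic (with_proj G) \<and>
           acyclic_b_chromatic_number (with_proj G) < 5} // graph_iso_rel)"
    (is "infinite (?A // _)")
proof -
  \<comment> \<open>\<open>K n\<close> consists of \<open>n\<close> copies of
    \<open>K\<^sub>4\<close> on consecutive blocks of four numbers. \<open>K 0\<close> is the empty
    graph, which is vacuously cubic.\<close>
  define K where "K n = cluster_graph {..<4 * n} (\<lambda>v. v div 4)" for n :: nat
  have K: "K n \<in> ?A" for n
  proof -
    have "card {w \<in> {..<4 * n}. w div 4 = v div 4} = 4" if "v \<in> {..<4 * n}" for v
      using that by (intro card_div_block) simp
    then show ?thesis
      using acyclic_b_chromatic_number_cluster_graph[of "{..<4 * n}" "\<lambda>v. v div 4" 4]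
        pair_graph_cluster_graph[of "{..<4 * n}" "\<lambda>v. v div 4"]
        cubic_cluster_graph[of "{..<4 * n}" "\<lambda>v. v div 4"]
      unfolding K_def by fastforce
  qed
  \<comment> \<open>Equal classes would make \<open>K m\<close> and \<open>K n\<close> isomorphic,
    but they have \<open>4 * m\<close> and \<open>4 * n\<close> vertices.\<close>
  have "inj (\<lambda>n. graph_iso_rel `` {K n})"
  proof (rule injI)
    fix m n assume "graph_iso_rel `` {K m} = graph_iso_rel `` {K n}"
    then have "(K m, K n) \<in> graph_iso_rel"
      using K[of n] by (intro eq_equiv_class[OF _ equiv_graph_iso_rel]) auto
    then have "card (verts (with_proj (K m))) = card (verts (with_proj (K n)))"
      by (intro digraph_iso_card_verts) (simp add: graph_iso_rel_def)
    then show "m = n" by (simp add: K_def)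
  qed
  moreover have "range (\<lambda>n. graph_iso_rel `` {K n}) \<subseteq> ?A // graph_iso_rel"
    using K by (auto intro: quotientI)
  ultimately show ?thesis
    using finite_subset range_inj_infinite by blast
qed

end
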